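(* Let $m\geq 1$ and $b\geq 2$ be integers and let $\Theta\subseteq\mathbb{R}^m$ be countable. Then \[ \dim_P\Big(\bigcap_{\underline{\theta}\in\Theta}\mathcal{W}_{m,\underline{\theta}}(\infty)\Big)=\dim_P\Big(\bigcap_{\underline{\theta}\in\Theta}\mathcal{W}^{(b)}_{m,\underline{\theta}}(\infty)\Big)=m . \]
   Context: Fix an arbitrary norm $\Vert\cdot\Vert$ on $\mathbb{R}^m$. For $\underline{x},\underline{\theta}\in\mathbb{R}^m$, the ordinary inhomogeneous exponent $\omega_{m,\underline{\theta}}(\underline{x})$ is the supremum of $w\geq 0$ such that the system $1\leq q\leq Q$, $\Vert q\underline{x}-\underline{p}-\underline{\theta}\Vert\leq Q^{-w}$ has an integer solution $(q,\underline{p})\in\mathbb{Z}\times\mathbb{Z}^m$ for arbitrarily large $Q$; $\omega^{(b)}_{m,\underline{\theta}}(\underline{x})$ is defined the same way with $q$ restricted to powers $b^N$, $N$ a positive integer. Set $\mathcal{W}_{m,\underline{\theta}}(\infty)=\{\underline{x}:\omega_{m,\underline{\theta}}(\underline{x})=\infty\}$ and $\mathcal{W}^{(b)}_{m,\underline{\theta}}(\infty)=\{\underline{x}:\omega^{(b)}_{m,\underline{\theta}}(\underline{x})=\infty\}$. $\dim_P$ is packing dimension. *)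

theory Defs
  imports "HOL-Analysis.Analysis"
begin

definition is_norm :: "('a::real_vector \<Rightarrow> real) \<Rightarrow> bool" where
  "is_norm N \<longleftrightarrow>
     (\<forall>x. N x = 0 \<longleftrightarrow> x = 0) \<and>
     (\<forall>c x. N (c *\<^sub>R x) = \<bar>c\<bar> * N x) \<and>
     (\<forall>x y. N (x + y) \<le> N x + N y)"

text \<open>The set \<open>A\<close> restricts the admissible integers \<open>q\<close>. The supremum is taken in the
  extended nonnegative reals, so it is \<open>0\<close> if no \<open>w\<close> qualifies.\<close>

definition inhom_exponent_on ::
    "int set \<Rightarrow> (real^'m \<Rightarrow> real) \<Rightarrow> real^'m \<Rightarrow> real^'m \<Rightarrow> ennreal" where
  "inhom_exponent_on A N \<theta> x =
     Sup {ennreal w | w. 0 \<le> w \<and>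
       (\<forall>Q\<^sub>0::real. \<exists>Q\<ge>Q\<^sub>0. \<exists>q\<in>A. \<exists>p. (\<forall>i. p $ i \<in> \<int>) \<and>
          1 \<le> q \<and> real_of_int q \<le> Q \<and>
          N (real_of_int q *\<^sub>R x - p - \<theta>) \<le> Q powr (- w))}"

definition inhom_exponent :: "(real^'m \<Rightarrow> real) \<Rightarrow> real^'m \<Rightarrow> real^'m \<Rightarrow> ennreal" where
  "inhom_exponent = inhom_exponent_on UNIV"

definition inhom_exponent_base ::
    "int \<Rightarrow> (real^'m \<Rightarrow> real) \<Rightarrow> real^'m \<Rightarrow> real^'m \<Rightarrow> ennreal" where
  "inhom_exponent_base b = inhom_exponent_on {b ^ n | n::nat. n \<ge> 1}"

definition W_inf :: "(real^'m \<Rightarrow> real) \<Rightarrow> real^'m \<Rightarrow> (real^'m) set" where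
  "W_inf N \<theta> = {x. inhom_exponent N \<theta> x = \<infinity>}"

definition W_inf_base :: "int \<Rightarrow> (real^'m \<Rightarrow> real) \<Rightarrow> real^'m \<Rightarrow> (real^'m) set" where
  "W_inf_base b N \<theta> = {x. inhom_exponent_base b N \<theta> x = \<infinity>}"

text \<open>A \<open>\<delta>\<close>-packing of \<open>E\<close> is a countable family of pairwise disjoint closed balls with
  centres in \<open>E\<close> and radii in \<open>(0, \<delta>]\<close>, encoded as a set of pairs (centre, radius).
  Balls, and hence the packing dimension, refer to the Euclidean metric.\<close>

definition packings :: "real \<Rightarrow> 'a::euclidean_space set \<Rightarrow> ('a \<times> real) set set" where
  "packings \<delta> E = {B. countable B \<and>
     (\<forall>(x, r)\<in>B. x \<in> E \<and> 0 < r \<and> r \<le> \<delta>) \<and>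
     pairwise (\<lambda>(x, r) (y, t). disjnt (cball x r) (cball y t)) B}"

definition packing_content :: "real \<Rightarrow> real \<Rightarrow> 'a::euclidean_space set \<Rightarrow> ennreal" where
  "packing_content s \<delta> E =
     (SUP B\<in>packings \<delta> E. \<Sum>\<^sub>\<infinity>(x, r)\<in>B. ennreal (diameter (cball x r) powr s))"

text \<open>The infimum is the limit as \<open>\<delta>\<close> tends to \<open>0\<close>; see \<open>packing_premeasure_tendsto\<close>.\<close>

definition packing_premeasure :: "real \<Rightarrow> 'a::euclidean_space set \<Rightarrow> ennreal" where
  "packing_premeasure s E = (INF \<delta>\<in>{0<..}. packing_content s \<delta> E)"

definition packing_measure :: "real \<Rightarrow> 'a::euclidean_space set \<Rightarrow> ennreal" where
  "packing_measure s E =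
     (INF F\<in>{F :: nat \<Rightarrow> 'a set. E \<subseteq> (\<Union>i. F i)}. \<Sum>i. packing_premeasure s (F i))"

definition packing_dim :: "'a::euclidean_space set \<Rightarrow> ennreal" where
  "packing_dim E = Inf {ennreal s | s. 0 \<le> s \<and> packing_measure s E = 0}"

lemma packing_content_mono:
  assumes "\<delta> \<le> \<epsilon>"
  shows "packing_content s \<delta> E \<le> packing_content s \<epsilon> E"
  unfolding packing_content_def
  by (rule SUP_subset_mono) (use assms in \<open>fastforce simp: packings_def\<close>)+

lemma packing_premeasure_tendsto:
  "((\<lambda>\<delta>. packing_content s \<delta> E) \<longlongrightarrow> packing_premeasure s E) (at_right 0)"
proof (rule order_tendstoI)
  fix a assume "a < packing_premeasure s E"
  then have "a < packing_content s \<delta> E" if "0 < \<delta>" for \<delta>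
    using that unfolding packing_premeasure_def
    by (meson INF_lower greaterThan_iff order_less_le_trans)
  then show "\<forall>\<^sub>F \<delta> in at_right 0. a < packing_content s \<delta> E"
    by (auto simp: eventually_at_right_less eventually_at_filter)
next
  fix a assume "packing_premeasure s E < a"
  then obtain \<epsilon> where "0 < \<epsilon>" "packing_content s \<epsilon> E < a"
    unfolding packing_premeasure_def by (auto simp: INF_less_iff)
  then show "\<forall>\<^sub>F \<delta> in at_right 0. packing_content s \<delta> E < a"
    unfolding eventually_at_right_field
    by (meson le_less_trans less_imp_le packing_content_mono)
qed

end

theory Submission
  imports Defs "HOL-Real_Asymp.Real_Asymp"
begin

text \<open>
  Both intersections contain a countable intersection of dense open sets: for fixed \<open>\<theta>\<close> and \<open>k\<close>,
  the points \<open>(p + \<theta>) / b\<^sup>n\<close> with \<open>n \<ge> k\<close> and \<open>p\<close> integral are dense, and small balls around them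
  consist of points that are well approximable to order \<open>k\<close>. A residual set \<open>E\<close> has full packing
  dimension: whenever it is covered by countably many sets, Baire's theorem makes one of them, \<open>F\<close>,
  dense in some ball. Perturbing a grid of mesh \<open>c / n\<close> in that ball to points of \<open>F\<close> yields
  packings by \<open>n\<^sup>m\<close> balls of radius of order \<open>1 / n\<close>, so the \<open>s\<close>-dimensional packing premeasure
  of \<open>F\<close> is infinite for all \<open>s < m\<close>. The upper bound \<open>m\<close> holds for every subset of the space by
  comparing volumes.
\<close>

section \<open>Packing dimension\<close>

text \<open>With d = \<open>DIM('a)\<close>, disjointness and volume bound the sum of all r^d by
  (R+1)^d. The surplus power (2r)^(s-d) is at most (2\<delta>)^(s-d), a factor that vanishes with
  \<delta> as soon as s > d.\<close>

lemma packing_content_bounded_le: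
  fixes F :: "'a::euclidean_space set" and s :: real
  assumes F: "F \<subseteq> cball 0 R" and s: "s \<ge> DIM('a)" and \<delta>: "0 < \<delta>" "\<delta> \<le> 1" and R: "R \<ge> 0"
  shows "packing_content s \<delta> F \<le>
    ennreal ((2 * \<delta>) powr (s - DIM('a)) * 2 ^ DIM('a) * (R + 1) ^ DIM('a))"
  unfolding packing_content_def
proof (rule SUP_least)
  fix B assume B: "B \<in> packings \<delta> F"
  let ?d = "DIM('a)"
  let ?K = "(2 * \<delta>) powr (s - ?d) * 2 ^ ?d"
  let ?V = "unit_ball_vol (real ?d)"
  have V: "?V > 0" by simp
  have B1: "x \<in> F" "0 < r" "r \<le> \<delta>" if "(x, r) \<in> B" for x r
    using B that by (auto simp: packings_def)
  \<comment> \<open>Finite subfamilies suffice: an infinite sum of nonnegative terms is the supremum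
    of its finite partial sums.\<close>
  have "(\<Sum>(x, r)\<in>S. ennreal (diameter (cball x r) powr s)) \<le> ennreal (?K * (R + 1) ^ ?d)"
    if S: "finite S" "S \<subseteq> B" for S
  proof -
    have disj: "disjoint_family_on (\<lambda>u. cball (fst u) (snd u)) S"
      unfolding disjoint_family_on_def
    proof (intro ballI impI)
      fix u v assume "u \<in> S" "v \<in> S" "u \<noteq> v"
      then have uv: "u \<in> B" "v \<in> B" "u \<noteq> v" using S(2) by auto
      have "pairwise (\<lambda>(x, r) (y, t). disjnt (cball x r) (cball y t)) B"
        using B by (simp add: packings_def)
      from pairwiseD[OF this uv] show "cball (fst u) (snd u) \<inter> cball (fst v) (snd v) = {}"
        by (simp add: case_prod_beta disjnt_def)
    qed
    have "(\<Sum>(x, r)\<in>S. ?V * r ^ ?d) = (\<Sum>u\<in>S. measure lborel (cball (fst u) (snd u)))"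
    proof (rule sum.cong[OF refl], clarify)
      fix x r assume "(x, r) \<in> S"
      then have "0 \<le> r" using B1[of x r] S(2) by auto
      then show "?V * r ^ ?d = measure lborel (cball (fst (x, r)) (snd (x, r)))"
        by (simp add: content_cball)
    qed
    also have "\<dots> = measure lborel (\<Union>u\<in>S. cball (fst u) (snd u))"
    proof (rule measure_finite_Union[symmetric, OF S(1) _ disj])
      fix u :: "'a \<times> real"
      show "emeasure lborel (cball (fst u) (snd u)) \<noteq> \<infinity>"
        using emeasure_lborel_cball_finite[of "fst u" "snd u"] by simp
    qed auto
    \<comment> \<open>Centres lie within R of the origin and radii are at most \<delta> \<le> 1,
      hence R + 1.\<close>
    also have "\<dots> \<le> measure lborel (cball (0::'a) (R + 1))"
    proof (rule measure_mono_fmeasurable)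
      show "(\<Union>u\<in>S. cball (fst u) (snd u)) \<subseteq> cball 0 (R + 1)"
      proof clarify
        fix x r y assume xr: "(x, r) \<in> S" and y: "y \<in> cball (fst (x, r)) (snd (x, r))"
        have "norm x \<le> R" "r \<le> 1"
          using B1[of x r] xr S(2) F \<delta> by (auto simp: subset_iff)
        then show "y \<in> cball 0 (R + 1)"
          using y norm_triangle_ineq[of x "y - x"] by (simp add: dist_norm norm_minus_commute)
      qed
      show "(\<Union>u\<in>S. cball (fst u) (snd u)) \<in> sets lborel"
        using S(1) by (intro sets.finite_UN) auto
      show "cball (0::'a) (R + 1) \<in> fmeasurable lborel"
        using emeasure_lborel_cball_finite by (intro fmeasurableI) auto
    qed
    also have "\<dots> = ?V * (R + 1) ^ ?d"
      using R by (simp add: content_cball)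
    finally have vol: "(\<Sum>(x, r)\<in>S. r ^ ?d) \<le> (R + 1) ^ ?d"
      using V by (simp add: case_prod_beta sum_distrib_left[symmetric])
    have "diameter (cball x r) powr s \<le> ?K * r ^ ?d" if "(x, r) \<in> S" for x r
    proof -
      have r: "0 < r" "r \<le> \<delta>" using B1 that S(2) by blast+
      have "(2 * r) powr s = (2 * r) powr (s - ?d) * (2 * r) powr real ?d"
        by (simp add: powr_add[symmetric])
      also have "\<dots> \<le> (2 * \<delta>) powr (s - ?d) * (2 * r) powr real ?d"
        using r s by (intro mult_right_mono powr_mono2) auto
      also have "(2 * r) powr real ?d = 2 ^ ?d * r ^ ?d"
        using r by (simp add: powr_realpow power_mult_distrib)
      finally show ?thesis using r by simp
    qed
    then have "(\<Sum>(x, r)\<in>S. diameter (cball x r) powr s) \<le> (\<Sum>(x, r)\<in>S. ?K * r ^ ?d)"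
      by (intro sum_mono) auto
    also have "\<dots> = ?K * (\<Sum>(x, r)\<in>S. r ^ ?d)"
      by (simp add: sum_distrib_left case_prod_beta)
    also have "\<dots> \<le> ?K * (R + 1) ^ ?d"
      using vol by (intro mult_left_mono) auto
    finally show ?thesis
      by (simp add: case_prod_beta sum_ennreal ennreal_leI)
  qed
  then show "(\<Sum>\<^sub>\<infinity>(x, r)\<in>B. ennreal (diameter (cball x r) powr s)) \<le> ennreal (?K * (R + 1) ^ ?d)"
    by (subst nonneg_infsum_complete) (auto intro!: SUP_least)
qed

lemma packing_premeasure_bounded_eq_0:
  fixes F :: "'a::euclidean_space set" and s :: real
  assumes F: "F \<subseteq> cball 0 R" and s: "s > DIM('a)" and R: "R \<ge> 0"
  shows "packing_premeasure s F = 0"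
proof -
  let ?g = "\<lambda>\<delta>. (2 * \<delta>) powr (s - DIM('a)) * 2 ^ DIM('a) * (R + 1) ^ DIM('a)"
  have "((\<lambda>\<delta>. (2 * \<delta>) powr (s - DIM('a))) \<longlongrightarrow> 0) (at_right 0)"
    using s by real_asymp
  then have "(?g \<longlongrightarrow> 0) (at_right 0)"
    by (intro tendsto_mult_left_zero)
  then have "((\<lambda>\<delta>. ennreal (?g \<delta>)) \<longlongrightarrow> ennreal 0) (at_right 0)"
    by (rule tendsto_ennrealI)
  moreover have "\<forall>\<^sub>F \<delta> in at_right 0. packing_premeasure s F \<le> ennreal (?g \<delta>)"
    unfolding eventually_at_right_field
  proof (intro exI[of _ 1] conjI allI impI)
    fix \<delta> :: real assume \<delta>: "0 < \<delta>" "\<delta> < 1"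
    then have "packing_premeasure s F \<le> packing_content s \<delta> F"
      unfolding packing_premeasure_def by (auto intro: INF_lower)
    also have "\<dots> \<le> ennreal (?g \<delta>)"
      using \<delta> assms by (intro packing_content_bounded_le) auto
    finally show "packing_premeasure s F \<le> ennreal (?g \<delta>)" .
  qed auto
  ultimately have "packing_premeasure s F \<le> ennreal 0"
    by (intro tendsto_lowerbound) auto
  then show ?thesis by simp
qed

text \<open>Countably many balls of integer radius cover the space, and each has premeasure 0 for
  every s > \<open>DIM('a)\<close>; then s decreases to \<open>DIM('a)\<close>.\<close>

lemma packing_dim_le_DIM:
  fixes E :: "'a::euclidean_space set"
  shows "packing_dim E \<le> of_nat DIM('a)"
proof -
  have "packing_dim E \<le> ennreal s" if s: "s > DIM('a)" for s :: real
  proof -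
    have "E \<subseteq> (\<Union>i. cball 0 (real i))"
      using real_arch_simple by auto
    then have "packing_measure s E \<le> (\<Sum>i. packing_premeasure s (cball (0::'a) (real i)))"
      unfolding packing_measure_def by (intro INF_lower) auto
    also have "\<dots> = 0"
      using s by (simp add: packing_premeasure_bounded_eq_0[OF order_refl])
    finally have "packing_measure s E = 0" by simp
    then show ?thesis
      unfolding packing_dim_def using s by (intro Inf_lower) auto
  qed
  then have "\<forall>\<^sub>F s in at_right (real DIM('a)). packing_dim E \<le> ennreal s"
    by (auto simp: eventually_at_filter)
  moreover have "((\<lambda>s. ennreal s) \<longlongrightarrow> ennreal (real DIM('a))) (at_right (real DIM('a)))"
    by (intro tendsto_ennrealI tendsto_ident_at)
  ultimately have "packing_dim E \<le> ennreal (real DIM('a))"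
    by (intro tendsto_lowerbound) auto
  then show ?thesis by (simp add: ennreal_of_nat_eq_real_of_nat)
qed

section \<open>Lower bound for residual sets\<close>

text \<open>A grid of mesh c/n with n points per coordinate direction fits in the ball. With r =
  c/(8n), grid points are at least 8r apart, and moving each by less than r into F leaves distances
  above 6r, so the closed r-balls stay disjoint. Each has diameter c/(4n).\<close>

lemma packing_content_ge_grid:
  fixes F :: "'a::euclidean_space set" and c :: real
  assumes ball: "ball z (DIM('a) * c) \<subseteq> closure F" and c: "c > 0"
    and n: "n \<ge> 1" and \<delta>: "c / (8 * real n) \<le> \<delta>"
  shows "ennreal (real n ^ DIM('a) * (c / (4 * real n)) powr s) \<le> packing_content s \<delta> F"
proof -
  let ?r = "c / (8 * real n)"
  let ?P = "(Basis :: 'a set) \<rightarrow>\<^sub>E {..<n}"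
  define y where "y f = z + (\<Sum>i\<in>Basis. (c * real (f i) / real n) *\<^sub>R i)" for f :: "'a \<Rightarrow> nat"
  have r: "?r > 0" using c n by simp
  have "\<exists>x\<in>F. dist x (y f) < ?r" if f: "f \<in> ?P" for f
  proof -
    \<comment> \<open>Each coordinate moves by less than c since f i < n, so the triangle inequality
      yields the radius \<open>DIM('a) * c\<close>.\<close>
    have "norm (y f - z) \<le> (\<Sum>i\<in>(Basis::'a set). norm ((c * real (f i) / real n) *\<^sub>R i))"
      unfolding y_def by (simp only: add_diff_cancel_left' norm_sum)
    also have "\<dots> < (\<Sum>i\<in>(Basis::'a set). c)"
    proof (rule sum_strict_mono)
      fix i :: 'a assume i: "i \<in> Basis"
      then have "f i < n" using f by auto
      then show "norm ((c * real (f i) / real n) *\<^sub>R i) < c"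
        using c i n by (simp add: field_simps)
    qed auto
    finally have "y f \<in> closure F"
      using ball by (auto simp: dist_norm norm_minus_commute)
    then show ?thesis using r by (simp add: closure_approachable)
  qed
  then obtain x where x: "\<And>f. f \<in> ?P \<Longrightarrow> x f \<in> F \<and> dist (x f) (y f) < ?r"
    by metis
  have sep: "dist (x f) (x g) > 2 * ?r" if fg: "f \<in> ?P" "g \<in> ?P" "f \<noteq> g" for f g
  proof -
    obtain i :: 'a where i: "i \<in> Basis" "f i \<noteq> g i"
      using fg PiE_ext by metis
    have "c / real n \<le> \<bar>(y f - y g) \<bullet> i\<bar>"
    proof -
      have "(y f - y g) \<bullet> i = c * (real (f i) - real (g i)) / real n"
        using i(1) unfolding y_def
        by (simp add: inner_diff_left inner_add_left inner_sum_left inner_Basis if_distrib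
            right_diff_distrib diff_divide_distrib cong: if_cong)
      moreover have "1 \<le> \<bar>real (f i) - real (g i)\<bar>" using i(2) by linarith
      ultimately show ?thesis
        using c n by (simp add: abs_mult divide_right_mono)
    qed
    also have "\<dots> \<le> dist (y f) (y g)"
      using i(1) by (simp add: dist_norm Basis_le_norm)
    finally have "8 * ?r \<le> dist (y f) (y g)" by simp
    moreover have "dist (y f) (y g) \<le> dist (x f) (y f) + dist (x f) (x g) + dist (x g) (y g)"
      by (smt (verit) dist_commute dist_triangle)
    ultimately show ?thesis using x[OF fg(1)] x[OF fg(2)] r by linarith
  qed
  let ?B = "(\<lambda>f. (x f, ?r)) ` ?P"
  \<comment> \<open>A packing is a set of pairs, so injectivity is what makes all n^d balls count in
    the sum.\<close>
  have inj: "inj_on (\<lambda>f. (x f, ?r)) ?P"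
  proof (rule inj_onI, rule ccontr)
    fix f g assume "f \<in> ?P" "g \<in> ?P" "(x f, ?r) = (x g, ?r)" "f \<noteq> g"
    then show False using sep[of f g] r by simp
  qed
  have fin: "finite ?P" by (simp add: finite_PiE)
  have "?B \<in> packings \<delta> F"
    unfolding packings_def
  proof (intro CollectI conjI)
    show "countable ?B" using fin by (intro countable_finite finite_imageI)
    show "\<forall>(x, r)\<in>?B. x \<in> F \<and> 0 < r \<and> r \<le> \<delta>"
    proof clarify
      fix f assume "f \<in> ?P"
      with x r \<delta> show "x f \<in> F \<and> 0 < ?r \<and> ?r \<le> \<delta>" by blast
    qed
    have "disjnt (cball (x f) ?r) (cball (x g) ?r)" if "f \<in> ?P" "g \<in> ?P" "f \<noteq> g" for f g
      unfolding disjnt_iff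
    proof clarify
      fix u assume "u \<in> cball (x f) ?r" "u \<in> cball (x g) ?r"
      then show False
        using sep[OF that] dist_triangle[of "x f" "x g" u] by (simp add: dist_commute)
    qed
    then show "pairwise (\<lambda>(x, r) (y, t). disjnt (cball x r) (cball y t)) ?B"
      unfolding pairwise_def by blast
  qed
  then have "(\<Sum>\<^sub>\<infinity>(x, r)\<in>?B. ennreal (diameter (cball x r) powr s)) \<le> packing_content s \<delta> F"
    unfolding packing_content_def by (rule SUP_upper)
  also have "(\<Sum>\<^sub>\<infinity>(x, r)\<in>?B. ennreal (diameter (cball x r) powr s)) =
      (\<Sum>f\<in>?P. ennreal (diameter (cball (x f) ?r) powr s))"
    using fin by (simp add: sum.reindex[OF inj])
  also have "\<dots> = of_nat (n ^ DIM('a)) * ennreal ((c / (4 * real n)) powr s)"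
    using r by (simp add: card_PiE)
  also have "\<dots> = ennreal (real n ^ DIM('a) * (c / (4 * real n)) powr s)"
    by (simp add: ennreal_mult ennreal_of_nat_eq_real_of_nat del: of_nat_power flip: of_nat_power)
  finally show ?thesis .
qed

text \<open>The grid packings contribute (c/4)^s * n^(d-s) with d = \<open>DIM('a)\<close>, which
  diverges for s < d, while their radii c/(8n) eventually fall below any \<delta>.\<close>

lemma packing_premeasure_somewhere_dense:
  fixes F :: "'a::euclidean_space set" and s :: real
  assumes int: "interior (closure F) \<noteq> {}" and s: "s < DIM('a)"
  shows "packing_premeasure s F = \<infinity>"
proof -
  obtain z \<rho> where \<rho>: "\<rho> > 0" "ball z \<rho> \<subseteq> closure F"
    using int mem_interior by blast
  define c where "c = \<rho> / DIM('a)"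
  have c: "c > 0" "ball z (DIM('a) * c) \<subseteq> closure F"
    using \<rho> by (auto simp: c_def)
  let ?g = "\<lambda>n. real n ^ DIM('a) * (c / (4 * real n)) powr s"
  have "filterlim (\<lambda>n. (c / 4) powr s * real n powr (real DIM('a) - s)) at_top sequentially"
  proof (rule filterlim_tendsto_pos_mult_at_top[OF tendsto_const])
    show "filterlim (\<lambda>n. real n powr (real DIM('a) - s)) at_top sequentially"
      using s by real_asymp
  qed (use c in auto)
  moreover have "\<forall>\<^sub>F n in sequentially. (c / 4) powr s * real n powr (real DIM('a) - s) = ?g n"
    using eventually_gt_at_top[of 0]
  proof eventually_elim
    case (elim n)
    have "(c / (4 * real n)) powr s = (c / 4) powr s / real n powr s"
      using c elim by (simp add: powr_divide powr_mult)
    then show ?case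
      using elim by (simp add: powr_diff powr_realpow)
  qed
  ultimately have lim: "filterlim ?g at_top sequentially"
    by (simp cong: filterlim_cong)
  have "packing_content s \<delta> F = \<infinity>" if \<delta>: "\<delta> > 0" for \<delta>
  proof -
    have "of_nat k \<le> packing_content s \<delta> F" for k
    proof -
      have "\<forall>\<^sub>F n in sequentially. c / (8 * real n) < \<delta>"
        using \<delta> by (intro order_tendstoD(2)[where y = 0]) real_asymp
      moreover have "\<forall>\<^sub>F n in sequentially. real k \<le> ?g n"
        using lim by (simp add: filterlim_at_top)
      \<comment> \<open>The inequality does not mention n, so holding eventually means holding
        outright.\<close>
      ultimately have "\<forall>\<^sub>F n in sequentially. of_nat k \<le> packing_content s \<delta> F"
        using eventually_ge_at_top[of 1]
      proof eventually_elim
        case (elim n)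
        have "of_nat k \<le> ennreal (?g n)"
          using elim by (simp add: ennreal_of_nat_eq_real_of_nat ennreal_leI)
        also have "\<dots> \<le> packing_content s \<delta> F"
          using elim c by (intro packing_content_ge_grid) auto
        finally show ?case .
      qed
      then show ?thesis by simp
    qed
    then show ?thesis
      by (metis ennreal_Ex_less_of_nat infinity_ennreal_def linorder_not_less top.not_eq_extremum)
  qed
  then show ?thesis
    unfolding packing_premeasure_def by (simp add: INF_eq_const)
qed

text \<open>If every \<open>closure (F i)\<close> had empty interior, the complements would be dense
  open sets. Baire's theorem, applied to them together with \<G>, gives a point of the intersection
  of \<G> that no F i contains.\<close>

lemma residual_cover_somewhere_dense:
  fixes \<G> :: "'a::euclidean_space set set" and F :: "nat \<Rightarrow> 'a set"
  assumes \<G>: "countable \<G>" "\<And>U. U \<in> \<G> \<Longrightarrow> open U \<and> closure U = UNIV"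
    and cover: "\<Inter>\<G> \<subseteq> (\<Union>i. F i)"
  obtains i where "interior (closure (F i)) \<noteq> {}"
proof (rule ccontr)
  assume "\<not> thesis"
  then have nd: "interior (closure (F i)) = {}" for i
    using that by blast
  let ?H = "\<G> \<union> range (\<lambda>i. - closure (F i))"
  have "UNIV \<subseteq> closure (\<Inter>?H)"
  proof (rule Baire)
    fix T assume "T \<in> ?H"
    then show "openin (top_of_set UNIV) T \<and> UNIV \<subseteq> closure T"
      using \<G>(2) nd by (auto simp: closure_complement)
  qed (use \<G>(1) in auto)
  then obtain x where "x \<in> \<Inter>?H"
    by (metis closure_empty ex_in_conv top.extremum_uniqueI empty_not_UNIV)
  moreover from this obtain i where "x \<in> F i" using cover by blast
  ultimately show False using closure_subset[of "F i"] by blast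
qed

text \<open>For s below the dimension, every countable cover has a somewhere dense member, whose
  infinite premeasure already makes the whole series infinite. Hence no such s competes in the
  infimum.\<close>

lemma packing_dim_residual:
  fixes E :: "'a::euclidean_space set"
  assumes \<G>: "countable \<G>" "\<And>U. U \<in> \<G> \<Longrightarrow> open U \<and> closure U = UNIV" and E: "\<Inter>\<G> \<subseteq> E"
  shows "packing_dim E = of_nat DIM('a)"
proof (rule antisym)
  have "real DIM('a) \<le> s" if s: "packing_measure s E = 0" for s
  proof (rule ccontr)
    assume "\<not> real DIM('a) \<le> s"
    then have less: "s < DIM('a)" by simp
    have "(\<Sum>i. packing_premeasure s (F i)) = \<infinity>" if F: "E \<subseteq> (\<Union>i. F i)" for F :: "nat \<Rightarrow> 'a set"
    proof -
      obtain i where i: "interior (closure (F i)) \<noteq> {}"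
        using residual_cover_somewhere_dense[OF \<G>] E F by (metis order_trans)
      have "packing_premeasure s (F i) \<le> (\<Sum>i. packing_premeasure s (F i))"
        using sum_le_suminf[of "\<lambda>i. packing_premeasure s (F i)" "{i}"] by simp
      then show ?thesis
        using packing_premeasure_somewhere_dense[OF i less] by (simp add: top_unique)
    qed
    then have "packing_measure s E = \<infinity>"
      unfolding packing_measure_def by (auto simp: top_unique intro!: INF_greatest antisym)
    then show False using s by simp
  qed
  then show "of_nat DIM('a) \<le> packing_dim E"
    unfolding packing_dim_def
    by (auto intro!: Inf_greatest ennreal_leI simp: ennreal_of_nat_eq_real_of_nat)
qed (rule packing_dim_le_DIM)

section \<open>Approximable points\<close>

text \<open>Expand x in the standard basis; each coordinate is at most the Euclidean norm in
  absolute value.\<close>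

lemma is_norm_le_norm:
  fixes N :: "real^'m \<Rightarrow> real"
  assumes "is_norm N"
  obtains C where "C > 0" "\<And>x. N x \<le> C * norm x"
proof -
  have N: "N 0 = 0" "\<And>c x. N (c *\<^sub>R x) = \<bar>c\<bar> * N x" "\<And>x y. N (x + y) \<le> N x + N y"
    using assms by (auto simp: is_norm_def)
  have N_sum: "N (\<Sum>i\<in>I. f i) \<le> (\<Sum>i\<in>I. N (f i))" if "finite I" for I :: "(real^'m) set" and f
    using that by induction (auto simp: N(1) intro: order_trans[OF N(3)])
  have N0: "N x \<ge> 0" for x
    using N(3)[of x "(-1) *\<^sub>R x"] N(2)[of "-1" x] by (simp add: N(1))
  show ?thesis
  \<comment> \<open>The summand 1 makes the constant positive from N \<ge> 0 alone.\<close>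
  proof (rule that[of "1 + (\<Sum>i\<in>Basis. N i)"])
    show "1 + (\<Sum>i\<in>(Basis::(real^'m) set). N i) > 0"
      using N0 by (simp add: add_pos_nonneg sum_nonneg)
    fix x :: "real^'m"
    have "N x = N (\<Sum>i\<in>Basis. (x \<bullet> i) *\<^sub>R i)"
      by (simp add: euclidean_representation)
    also have "\<dots> \<le> (\<Sum>i\<in>Basis. \<bar>x \<bullet> i\<bar> * N i)"
      using N_sum[of Basis "\<lambda>i. (x \<bullet> i) *\<^sub>R i"] by (simp add: N(2))
    also have "\<dots> \<le> (\<Sum>i\<in>Basis. norm x * N i)"
      by (intro sum_mono mult_right_mono N0 Basis_le_norm)
    also have "\<dots> \<le> (1 + (\<Sum>i\<in>Basis. N i)) * norm x"
      by (simp add: distrib_right flip: sum_distrib_left)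
    finally show "N x \<le> (1 + (\<Sum>i\<in>Basis. N i)) * norm x" .
  qed
qed

lemma inhom_exponent_on_mono:
  "A \<subseteq> A' \<Longrightarrow> inhom_exponent_on A N \<theta> x \<le> inhom_exponent_on A' N \<theta> x"
  unfolding inhom_exponent_on_def by (rule Sup_subset_mono) blast

lemma W_inf_base_subset_W_inf: "W_inf_base b N \<theta> \<subseteq> W_inf N \<theta>"
proof
  fix x assume "x \<in> W_inf_base b N \<theta>"
  moreover have "inhom_exponent_base b N \<theta> x \<le> inhom_exponent N \<theta> x"
    unfolding inhom_exponent_base_def inhom_exponent_def by (intro inhom_exponent_on_mono) simp
  ultimately show "x \<in> W_inf N \<theta>"
    by (simp add: W_inf_base_def W_inf_def top_unique)
qed

text \<open>The factor \<open>C\<close> compares the given norm with the Euclidean one.\<close>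

definition approx_nhd :: "int \<Rightarrow> real \<Rightarrow> real^'m \<Rightarrow> nat \<Rightarrow> (real^'m) set" where
  "approx_nhd b C \<theta> k = (\<Union>n\<in>{max 1 k..}. \<Union>p\<in>{p. \<forall>i. p $ i \<in> \<int>}.
     ball ((1 / of_int b ^ n) *\<^sub>R (p + \<theta>)) ((of_int b ^ n) powr (- real k) / (C * of_int b ^ n)))"

section \<open>Dense open sets of well approximable points\<close>

lemma open_approx_nhd: "open (approx_nhd b C \<theta> k)"
  unfolding approx_nhd_def by auto

lemma power_int_eventually_ge:
  fixes b :: int and B :: real
  assumes "b \<ge> 2"
  obtains n where "n \<ge> k" "n \<ge> 1" "of_int b ^ n \<ge> B"
proof -
  obtain n where n: "B < 2 ^ n"
    using real_arch_pow[of 2 B] by auto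
  \<comment> \<open>The exponent n + k + 1 meets all three demands at once.\<close>
  have "(2::real) ^ n \<le> 2 ^ (n + k + 1)" by (rule power_increasing) auto
  also have "\<dots> \<le> of_int b ^ (n + k + 1)" using assms by (intro power_mono) auto
  finally show ?thesis using n that[of "n + k + 1"] by simp
qed

text \<open>Rounding q x - \<theta> down coordinatewise, with q = b^n, gives an integral p at
  distance at most \<open>CARD('m)\<close>. Division by q puts the centre (p + \<theta>)/q within
  \<open>CARD('m)\<close> / q of x.\<close>

lemma dense_approx_nhd:
  fixes \<theta> :: "real^'m"
  assumes b: "b \<ge> 2" and C: "C > 0"
  shows "closure (approx_nhd b C \<theta> k) = UNIV"
proof -
  have "\<exists>y\<in>approx_nhd b C \<theta> k. dist y x < e" if e: "e > 0" for x e
  proof -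
    \<comment> \<open>The added 1 turns the bound into the strict
      \<open>CARD('m) / ?q < e\<close>.\<close>
    obtain n where n: "n \<ge> k" "n \<ge> 1" "of_int b ^ n \<ge> real CARD('m) / e + 1"
      using power_int_eventually_ge[OF b] .
    let ?q = "(of_int b :: real) ^ n"
    have q: "?q > 0" using b by simp
    define p :: "real^'m" where "p = (\<chi> i. of_int \<lfloor>(?q *\<^sub>R x - \<theta>) $ i\<rfloor>)"
    let ?y = "(1 / ?q) *\<^sub>R (p + \<theta>)"
    have "norm (?q *\<^sub>R x - \<theta> - p) \<le> (\<Sum>i\<in>UNIV. \<bar>(?q *\<^sub>R x - \<theta> - p) $ i\<bar>)"
      by (rule norm_le_l1_cart)
    also have "\<dots> \<le> (\<Sum>i\<in>(UNIV::'m set). 1)"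
    proof (rule sum_mono)
      fix i
      show "\<bar>(?q *\<^sub>R x - \<theta> - p) $ i\<bar> \<le> 1"
        using floor_correct[of "(?q *\<^sub>R x - \<theta>) $ i"] unfolding p_def
        by (simp add: abs_le_iff) linarith
    qed
    finally have le: "norm (?q *\<^sub>R x - \<theta> - p) \<le> CARD('m)" by simp
    have "x - ?y = (1 / ?q) *\<^sub>R (?q *\<^sub>R x - \<theta> - p)"
      using b by (simp add: algebra_simps)
    then have "dist ?y x = norm (?q *\<^sub>R x - \<theta> - p) / ?q"
      using q b by (simp add: dist_norm norm_minus_commute)
    also have "\<dots> \<le> CARD('m) / ?q"
      using le q by (simp add: divide_right_mono)
    also have "\<dots> < e"
    proof -
      have "real CARD('m) / e < ?q" using n(3) by linarith
      then show ?thesis using e q by (simp add: field_simps)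
    qed
    finally have "dist ?y x < e" .
    moreover have "?y \<in> approx_nhd b C \<theta> k"
      unfolding approx_nhd_def
    proof (intro UN_I)
      show "n \<in> {max 1 k..}" using n by simp
      show "p \<in> {p. \<forall>i. p $ i \<in> \<int>}" by (simp add: p_def)
      show "?y \<in> ball ?y (?q powr (- real k) / (C * ?q))"
        using q C b by (simp add: zero_less_divide_iff zero_less_mult_iff)
    qed
    ultimately show ?thesis by blast
  qed
  then show ?thesis by (auto simp: closure_approachable)
qed

text \<open>The radius q^(-k) / (C q) is chosen so that scaling by q and passing from the Euclidean
  norm to N leaves exactly q^(-k). Membership for all k then realises every natural exponent w,
  which forces the supremum to be infinite.\<close>

lemma Inter_approx_nhd_subset:
  fixes N :: "real^'m \<Rightarrow> real"
  assumes b: "b \<ge> 2" and C: "C > 0" "\<And>x. N x \<le> C * norm x"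
  shows "(\<Inter>k. approx_nhd b C \<theta> k) \<subseteq> W_inf_base b N \<theta>"
proof
  fix x assume x: "x \<in> (\<Inter>k. approx_nhd b C \<theta> k)"
  let ?A = "{b ^ n | n::nat. n \<ge> 1}"
  have "ennreal (real w) \<le> inhom_exponent_base b N \<theta> x" for w :: nat
    unfolding inhom_exponent_base_def inhom_exponent_on_def
  proof (rule Sup_upper, rule CollectI, rule exI[of _ "real w"], intro conjI allI)
    fix Q\<^sub>0 :: real
    \<comment> \<open>One k serves two purposes: k \<ge> w gives the exponent, and n \<ge> k makes q
      = b^n at least \<open>Q\<^sub>0\<close>, so that Q = q is a witness.\<close>
    obtain k where k: "k \<ge> w" "of_int b ^ k \<ge> Q\<^sub>0"
      using power_int_eventually_ge[OF b] .
    from x have "x \<in> approx_nhd b C \<theta> k" by blast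
    then obtain n p where n: "n \<ge> 1" "n \<ge> k" and p: "\<forall>i. p $ i \<in> \<int>" and
      near: "x \<in> ball ((1 / of_int b ^ n) *\<^sub>R (p + \<theta>))
        ((of_int b ^ n) powr (- real k) / (C * of_int b ^ n))"
      unfolding approx_nhd_def by auto
    let ?q = "(of_int b :: real) ^ n"
    have q: "?q \<ge> 1" "?q > 0" using b by simp_all
    have "?q *\<^sub>R x - p - \<theta> = ?q *\<^sub>R (x - (1 / ?q) *\<^sub>R (p + \<theta>))"
      using b by (simp add: algebra_simps)
    then have "norm (?q *\<^sub>R x - p - \<theta>) = ?q * dist ((1 / ?q) *\<^sub>R (p + \<theta>)) x"
      using q by (simp only: norm_scaleR dist_norm norm_minus_commute abs_of_pos)
    also have "\<dots> \<le> ?q * (?q powr (- real k) / (C * ?q))"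
      using near q by (intro mult_left_mono) auto
    also have "\<dots> = ?q powr (- real k) / C" using q by simp
    finally have "C * norm (?q *\<^sub>R x - p - \<theta>) \<le> ?q powr (- real k)"
      using C(1) by (simp add: field_simps)
    also have "\<dots> \<le> ?q powr (- real w)"
      using q k by (intro powr_mono) auto
    finally have "N (?q *\<^sub>R x - p - \<theta>) \<le> ?q powr (- real w)"
      using C(2)[of "?q *\<^sub>R x - p - \<theta>"] by linarith
    moreover have "?q \<ge> Q\<^sub>0"
      using b k(2) by (intro order_trans[OF k(2) power_increasing[OF n(2)]]) simp
    moreover have "b ^ n \<in> ?A" "1 \<le> b ^ n" using n b by auto
    ultimately show "\<exists>Q\<ge>Q\<^sub>0. \<exists>q\<in>?A. \<exists>p. (\<forall>i. p $ i \<in> \<int>) \<and> 1 \<le> q \<and> real_of_int q \<le> Q \<and>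
        N (real_of_int q *\<^sub>R x - p - \<theta>) \<le> Q powr (- real w)"
      using p by (intro exI[of _ ?q] conjI bexI[of _ "b ^ n"] exI[of _ p]) auto
  qed auto
  then have "of_nat w \<le> inhom_exponent_base b N \<theta> x" for w :: nat
    by (simp add: ennreal_of_nat_eq_real_of_nat)
  then have "inhom_exponent_base b N \<theta> x = \<infinity>"
    by (metis ennreal_Ex_less_of_nat infinity_ennreal_def linorder_not_less top.not_eq_extremum)
  then show "x \<in> W_inf_base b N \<theta>" by (simp add: W_inf_base_def)
qed

theorem theorem2p7:
  fixes N :: "real^'m \<Rightarrow> real" and b :: int and \<Theta> :: "(real^'m) set"
  assumes "is_norm N" and "b \<ge> 2" and "countable \<Theta>"
  shows "packing_dim (\<Inter>\<theta>\<in>\<Theta>. W_inf N \<theta>) = of_nat CARD('m) \<and>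
         packing_dim (\<Inter>\<theta>\<in>\<Theta>. W_inf_base b N \<theta>) = of_nat CARD('m)"
proof -
  obtain C where C: "C > 0" "\<And>x. N x \<le> C * norm x"
    using is_norm_le_norm[OF assms(1)] by blast
  \<comment> \<open>Pooling the sets over all \<theta> and k keeps the family countable, so one
    residual set serves every \<theta> simultaneously; C depends only on N.\<close>
  let ?\<G> = "\<Union>\<theta>\<in>\<Theta>. range (approx_nhd b C \<theta>)"
  have \<G>: "countable ?\<G>" "\<And>U. U \<in> ?\<G> \<Longrightarrow> open U \<and> closure U = UNIV"
    using assms(2,3) C(1) by (auto simp: open_approx_nhd dense_approx_nhd)
  have base: "\<Inter>?\<G> \<subseteq> (\<Inter>\<theta>\<in>\<Theta>. W_inf_base b N \<theta>)"
  proof (rule INT_greatest)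
    fix \<theta> assume "\<theta> \<in> \<Theta>"
    then have "\<Inter>?\<G> \<subseteq> (\<Inter>k. approx_nhd b C \<theta> k)" by blast
    also have "\<dots> \<subseteq> W_inf_base b N \<theta>" by (rule Inter_approx_nhd_subset[OF assms(2) C])
    finally show "\<Inter>?\<G> \<subseteq> W_inf_base b N \<theta>" .
  qed
  \<comment> \<open>Restricting q to powers of b only lowers the exponent, so the unrestricted
    intersection contains the same residual set.\<close>
  also have "\<dots> \<subseteq> (\<Inter>\<theta>\<in>\<Theta>. W_inf N \<theta>)"
    using W_inf_base_subset_W_inf by (intro INF_mono) blast
  finally have "packing_dim (\<Inter>\<theta>\<in>\<Theta>. W_inf N \<theta>) = of_nat DIM(real^'m)"
    by (rule packing_dim_residual[OF \<G>(1), rotated]) (rule \<G>(2))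
  moreover have "packing_dim (\<Inter>\<theta>\<in>\<Theta>. W_inf_base b N \<theta>) = of_nat DIM(real^'m)"
    using base by (rule packing_dim_residual[OF \<G>(1), rotated]) (rule \<G>(2))
  ultimately show ?thesis by simp
qed

end
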